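(* Let $G$ be a finite group and let $\chi\in\operatorname{Irr}(G)$ be monomial. Then \[ \lambda(\chi)\geq \frac12 . \]
   Context: For a finite group $G$, $\operatorname{Irr}(G)$ denotes the set of irreducible complex characters of $G$. For $\chi\in\operatorname{Irr}(G)$ define \[ \lambda(\chi)=\frac{1}{|G|}\bigl|\{g\in G:\chi(g)=0\text{ or }\chi(g)\text{ is a root of unity}\}\bigr| . \] If $H\leq G$ and $\theta$ is a character of $H$, then $\theta^G$ denotes the character of $G$ induced from $\theta$. An irreducible character $\chi$ of $G$ is monomial if $\chi=\mu^G$ for some linear (i.e. degree one) character $\mu$ of some subgroup of $G$. *)

theory Defs
  imports "HOL-Algebra.Coset" "Jordan_Normal_Form.VS_Connect"
begin

text \<open>
  Representations are homomorphisms into the general linear group, which is the group of units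
  of the ring of complex n x n matrices.
\<close>
definition representation :: "('a, 'b) monoid_scheme \<Rightarrow> nat \<Rightarrow> ('a \<Rightarrow> complex mat) \<Rightarrow> bool" where
  "representation G n \<rho> \<longleftrightarrow> n > 0 \<and> \<rho> \<in> hom G (units_of (ring_mat TYPE(complex) n ()))"

definition invariant_subspace ::
    "('a, 'b) monoid_scheme \<Rightarrow> nat \<Rightarrow> ('a \<Rightarrow> complex mat) \<Rightarrow> complex vec set \<Rightarrow> bool" where
  "invariant_subspace G n \<rho> W \<longleftrightarrow>
     VectorSpace.subspace class_ring W (module_vec TYPE(complex) n) \<and>
     (\<forall>g\<in>carrier G. \<forall>w\<in>W. \<rho> g *\<^sub>v w \<in> W)"

definition irreducible_representation ::
    "('a, 'b) monoid_scheme \<Rightarrow> nat \<Rightarrow> ('a \<Rightarrow> complex mat) \<Rightarrow> bool" where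
  "irreducible_representation G n \<rho> \<longleftrightarrow> representation G n \<rho> \<and>
     (\<forall>W. invariant_subspace G n \<rho> W \<longrightarrow> W = {0\<^sub>v n} \<or> W = carrier_vec n)"

definition mat_trace :: "complex mat \<Rightarrow> complex" where
  "mat_trace A = (\<Sum>i<dim_row A. A $$ (i, i))"

text \<open>
  Characters are functions on the carrier, that is, they take the value \<^term>\<open>undefined\<close> outside it;
  hence equality of characters is HOL equality.
\<close>
definition character_of :: "('a, 'b) monoid_scheme \<Rightarrow> ('a \<Rightarrow> complex mat) \<Rightarrow> 'a \<Rightarrow> complex" where
  "character_of G \<rho> = (\<lambda>g\<in>carrier G. mat_trace (\<rho> g))"

definition characters :: "('a, 'b) monoid_scheme \<Rightarrow> ('a \<Rightarrow> complex) set" where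
  "characters G = {character_of G \<rho> | n \<rho>. representation G n \<rho>}"

definition Irr :: "('a, 'b) monoid_scheme \<Rightarrow> ('a \<Rightarrow> complex) set" where
  "Irr G = {character_of G \<rho> | n \<rho>. irreducible_representation G n \<rho>}"

text \<open>The value of a character at the identity is its degree.\<close>
definition linear_characters :: "('a, 'b) monoid_scheme \<Rightarrow> ('a \<Rightarrow> complex) set" where
  "linear_characters G = {\<mu> \<in> characters G. \<mu> \<one>\<^bsub>G\<^esub> = 1}"

definition induced ::
    "('a, 'b) monoid_scheme \<Rightarrow> 'a set \<Rightarrow> ('a \<Rightarrow> complex) \<Rightarrow> 'a \<Rightarrow> complex" where
  "induced G H \<theta> = (\<lambda>g\<in>carrier G.
     (\<Sum>x\<in>carrier G.
        if x \<otimes>\<^bsub>G\<^esub> g \<otimes>\<^bsub>G\<^esub> inv\<^bsub>G\<^esub> x \<in> H then \<theta> (x \<otimes>\<^bsub>G\<^esub> g \<otimes>\<^bsub>G\<^esub> inv\<^bsub>G\<^esub> x) else 0)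
     / of_nat (card H))"

definition monomial :: "('a, 'b) monoid_scheme \<Rightarrow> ('a \<Rightarrow> complex) \<Rightarrow> bool" where
  "monomial G \<chi> \<longleftrightarrow>
     (\<exists>H \<mu>. subgroup H G \<and> \<mu> \<in> linear_characters (G\<lparr>carrier := H\<rparr>) \<and> \<chi> = induced G H \<mu>)"

definition root_of_unity :: "complex \<Rightarrow> bool" where
  "root_of_unity z \<longleftrightarrow> (\<exists>m::nat. m > 0 \<and> z ^ m = 1)"

definition lambda_ratio :: "('a, 'b) monoid_scheme \<Rightarrow> ('a \<Rightarrow> complex) \<Rightarrow> real" where
  "lambda_ratio G \<chi> =
     real (card {g \<in> carrier G. \<chi> g = 0 \<or> root_of_unity (\<chi> g)}) / real (Coset.order G)"

end

theory Submission
  imports Defs "HOL-Algebra.Multiplicative_Group"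
begin

text \<open>
  Let \<open>\<chi> = \<mu>\<^sup>G\<close> with \<open>\<mu>\<close> a linear character of \<open>H\<close>, and let \<open>G\<close> act on the cosets \<open>H x\<close> by right
  multiplication. The coset \<open>H x\<close> is fixed by \<open>g\<close> iff \<open>x g x\<inverse> \<in> H\<close>, and the induction formula says
  that \<open>\<chi> g\<close> is the sum of the values \<open>\<mu> (x g x\<inverse>)\<close>, one for each fixed coset. Each such value is a
  root of unity. Hence \<open>\<chi> g\<close> is zero if \<open>g\<close> fixes no coset and a root of unity if \<open>g\<close> fixes
  exactly one, so every exceptional \<open>g\<close> fixes at least two cosets. But the action is transitive,
  so an element of \<open>G\<close> fixes one coset on average, and by Markov's inequality at most half of the
  elements fix two or more.

  In place of the fixed cosets themselves, the proof uses the set \<open>conjugators G H g\<close> of all \<open>x\<close> with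
  \<open>x g x\<inverse> \<in> H\<close>. It is the union of the fixed cosets, so its cardinality is \<open>card H\<close> times their
  number. The average is then the double count \<open>sum_card_conjugators\<close>, and
  \<open>induced_zero_or_root_of_unity\<close> treats the elements that fix at most one coset.
\<close>

lemma linear_character_mult_one:
  assumes H: "group H" and \<mu>: "\<mu> \<in> linear_characters H"
  shows linear_character_mult:
      "\<And>x y. x \<in> carrier H \<Longrightarrow> y \<in> carrier H \<Longrightarrow> \<mu> (x \<otimes>\<^bsub>H\<^esub> y) = \<mu> x * \<mu> y"
    and linear_character_one: "\<mu> \<one>\<^bsub>H\<^esub> = 1"
proof -
  interpret H: group H by fact
  show one: "\<mu> \<one>\<^bsub>H\<^esub> = 1" using \<mu> by (simp add: linear_characters_def)
  obtain n \<rho> where \<mu>_def: "\<mu> = character_of H \<rho>" and rep: "representation H n \<rho>"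
    using \<mu> by (auto simp: linear_characters_def characters_def)
  let ?R = "ring_mat TYPE(complex) n ()"
  interpret R: ring ?R by (rule ring_mat)
  interpret U: group "units_of ?R" by (rule R.units_group)
  have hom: "\<rho> \<in> hom H (units_of ?R)" using rep by (simp add: representation_def)
  have "\<rho> \<one>\<^bsub>H\<^esub> = 1\<^sub>m n"
    using hom_one[OF hom H.is_group U.is_group] by (simp add: units_of_one ring_mat_simps)
  hence "\<mu> \<one>\<^bsub>H\<^esub> = of_nat n" by (simp add: \<mu>_def character_of_def mat_trace_def)
  hence n: "n = 1" using one by (metis of_nat_eq_1_iff)
  have carr: "\<rho> x \<in> carrier_mat 1 1" if "x \<in> carrier H" for x
  proof -
    have "\<rho> x \<in> Units ?R" using hom_in_carrier[OF hom that] by (simp add: units_of_carrier)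
    hence "\<rho> x \<in> carrier ?R" by (rule R.Units_closed)
    thus ?thesis by (simp add: ring_mat_simps n)
  qed
  have entry: "\<mu> x = \<rho> x $$ (0, 0)" if "x \<in> carrier H" for x
    using that carr[OF that] by (simp add: \<mu>_def character_of_def mat_trace_def)
  show "\<mu> (x \<otimes>\<^bsub>H\<^esub> y) = \<mu> x * \<mu> y" if x: "x \<in> carrier H" and y: "y \<in> carrier H" for x y
  proof -
    have "\<rho> (x \<otimes>\<^bsub>H\<^esub> y) = \<rho> x * \<rho> y"
      using hom_mult[OF hom x y] by (simp add: units_of_mult ring_mat_simps)
    thus ?thesis
      using carr[OF x] carr[OF y] x y
      by (simp add: entry scalar_prod_def)
  qed
qed

lemma linear_character_root_of_unity:
  assumes H: "group H" and fin: "finite (carrier H)" and \<mu>: "\<mu> \<in> linear_characters H"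
    and x: "x \<in> carrier H"
  shows "root_of_unity (\<mu> x)"
proof -
  interpret H: group H by fact
  have "\<mu> (x [^]\<^bsub>H\<^esub> k) = \<mu> x ^ k" for k :: nat
    by (induction k)
      (simp_all add: linear_character_one[OF H \<mu>] linear_character_mult[OF H \<mu>] x)
  hence "\<mu> x ^ Coset.order H = 1"
    using H.pow_order_eq_1[OF x] linear_character_one[OF H \<mu>] by metis
  moreover have "Coset.order H > 0" using fin H.order_gt_0_iff_finite by blast
  ultimately show ?thesis by (auto simp: root_of_unity_def)
qed

text \<open>
  Complex numbers commute, so the values at \<open>h\<close> and its inverse cancel. Thus the summand
  \<open>\<mu> (x g x\<inverse>)\<close> of the induction formula depends only on the coset \<open>H x\<close>.
\<close>
lemma linear_character_conjugate:
  assumes H: "group H" and \<mu>: "\<mu> \<in> linear_characters H"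
    and h: "h \<in> carrier H" and x: "x \<in> carrier H"
  shows "\<mu> (h \<otimes>\<^bsub>H\<^esub> x \<otimes>\<^bsub>H\<^esub> inv\<^bsub>H\<^esub> h) = \<mu> x"
proof -
  interpret H: group H by fact
  have "\<mu> h * \<mu> (inv\<^bsub>H\<^esub> h) = 1"
    using linear_character_mult[OF H \<mu>, of h "inv\<^bsub>H\<^esub> h"] h linear_character_one[OF H \<mu>] by simp
  thus ?thesis
    using h x by (simp add: linear_character_mult[OF H \<mu>] mult.commute mult.left_commute)
qed

definition conjugators :: "('a, 'b) monoid_scheme \<Rightarrow> 'a set \<Rightarrow> 'a \<Rightarrow> 'a set" where
  "conjugators G H g = {x \<in> carrier G. x \<otimes>\<^bsub>G\<^esub> g \<otimes>\<^bsub>G\<^esub> inv\<^bsub>G\<^esub> x \<in> H}"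

context group
begin

lemma conj_mult:
  assumes "h \<in> carrier G" "x \<in> carrier G" "g \<in> carrier G"
  shows "(h \<otimes> x) \<otimes> g \<otimes> inv (h \<otimes> x) = h \<otimes> (x \<otimes> g \<otimes> inv x) \<otimes> inv h"
  using assms by (simp add: inv_mult_group m_assoc)

lemma rcoset_subset_conjugators:
  assumes H: "subgroup H G" and g: "g \<in> carrier G" and x: "x \<in> conjugators G H g"
  shows "H #> x \<subseteq> conjugators G H g"
proof
  fix y assume "y \<in> H #> x"
  then obtain h where h: "h \<in> H" and y: "y = h \<otimes> x" by (auto simp: r_coset_def)
  have x': "x \<in> carrier G" and c: "x \<otimes> g \<otimes> inv x \<in> H" using x by (auto simp: conjugators_def)
  have h': "h \<in> carrier G" using subgroup.mem_carrier[OF H h] .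
  have "h \<otimes> (x \<otimes> g \<otimes> inv x) \<otimes> inv h \<in> H"
    using H h c by (meson subgroup.m_closed subgroup.m_inv_closed)
  thus "y \<in> conjugators G H g" using conj_mult[OF h' x' g] y h' x' by (simp add: conjugators_def)
qed

text \<open>
  For fixed \<open>x\<close>, conjugation by \<open>x\<close> permutes \<open>G\<close>, so exactly \<open>card H\<close> elements \<open>g\<close> are sent into
  \<open>H\<close>. Counting the pairs \<open>(g, x)\<close> in the other order gives the sum. After division by \<open>card H\<close>
  this says that the elements of \<open>G\<close> fix one coset of \<open>H\<close> on average.
\<close>
lemma sum_card_conjugators:
  assumes fin: "finite (carrier G)" and H: "subgroup H G"
  shows "(\<Sum>g\<in>carrier G. card (conjugators G H g)) = card (carrier G) * card H"
proof -
  have "(\<Sum>g\<in>carrier G. card (conjugators G H g))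
      = (\<Sum>x\<in>carrier G. card {g \<in> carrier G. x \<otimes> g \<otimes> inv x \<in> H})"
    unfolding conjugators_def
    using sum.swap_restrict[OF fin fin, of "\<lambda>_ _. 1::nat" "\<lambda>g x. x \<otimes> g \<otimes> inv x \<in> H"]
    by simp
  also have "\<dots> = (\<Sum>x\<in>carrier G. card H)"
  proof (rule sum.cong[OF refl])
    fix x assume x: "x \<in> carrier G"
    have sub: "h \<in> carrier G" if "h \<in> H" for h using subgroup.mem_carrier[OF H that] .
    have cancel: "inv x \<otimes> (x \<otimes> a) = a" "x \<otimes> (inv x \<otimes> a) = a" if "a \<in> carrier G" for a
      using x that by (simp_all flip: m_assoc)
    have "bij_betw (\<lambda>g. x \<otimes> g \<otimes> inv x) {g \<in> carrier G. x \<otimes> g \<otimes> inv x \<in> H} H"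
      by (rule bij_betw_byWitness[where f' = "\<lambda>h. inv x \<otimes> h \<otimes> x"])
        (use x sub in \<open>auto simp: m_assoc cancel\<close>)
    thus "card {g \<in> carrier G. x \<otimes> g \<otimes> inv x \<in> H} = card H" by (rule bij_betw_same_card)
  qed
  finally show ?thesis by simp
qed

text \<open>
  Fewer than two fixed cosets means that the conjugators form either the empty set or a single
  coset \<open>H x\<close>. On that coset the summand of the induction formula is constantly \<open>\<mu> (x g x\<inverse>)\<close>, and the
  division by \<open>card H\<close> leaves this one value.
\<close>
lemma induced_zero_or_root_of_unity:
  assumes fin: "finite (carrier G)" and H: "subgroup H G"
    and \<mu>: "\<mu> \<in> linear_characters (G\<lparr>carrier := H\<rparr>)"
    and g: "g \<in> carrier G" and few: "card (conjugators G H g) < 2 * card H"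
  shows "induced G H \<mu> g = 0 \<or> root_of_unity (induced G H \<mu> g)"
proof -
  let ?C = "conjugators G H g" and ?K = "G\<lparr>carrier := H\<rparr>"
  have K: "group ?K" using subgroup.subgroup_is_group[OF H is_group] .
  have finC: "finite ?C" using fin by (simp add: conjugators_def)
  have HG: "H \<subseteq> carrier G" using subgroup.subset[OF H] .
  have finH: "finite H" using finite_subset[OF HG fin] .
  have cardH: "card H > 0" using finH subgroup.one_closed[OF H] card_gt_0_iff by blast
  have ind: "induced G H \<mu> g = (\<Sum>x\<in>?C. \<mu> (x \<otimes> g \<otimes> inv x)) / of_nat (card H)"
    using g fin by (simp add: induced_def conjugators_def sum.inter_filter)
  show ?thesis
  proof (cases "?C = {}")
    case True
    thus ?thesis by (simp add: ind)
  next
    case False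
    then obtain x where x: "x \<in> ?C" by blast
    hence x': "x \<in> carrier G" and c: "x \<otimes> g \<otimes> inv x \<in> H" by (auto simp: conjugators_def)
    have card_coset: "card (H #> y) = card H" if "y \<in> carrier G" for y
      using card_rcosets_equal[OF _ HG] rcosetsI[OF HG that] by simp
    have C: "?C = H #> x"
    proof (rule ccontr)
      assume "?C \<noteq> H #> x"
      then obtain y where y: "y \<in> ?C" "y \<notin> H #> x"
        using rcoset_subset_conjugators[OF H g x] by blast
      hence y': "y \<in> carrier G" by (simp add: conjugators_def)
      have "(H #> x) \<inter> (H #> y) = {}"
        using y rcos_self[OF y' H] rcos_disjoint[OF H] rcosetsI[OF HG x'] rcosetsI[OF HG y']
        by (metis pairwiseD disjnt_def)
      hence "card ((H #> x) \<union> (H #> y)) = 2 * card H"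
        using card_coset x' y' finC rcoset_subset_conjugators[OF H g x]
          rcoset_subset_conjugators[OF H g y(1)]
        by (subst card_Un_disjoint) (auto intro: finite_subset)
      moreover have "card ((H #> x) \<union> (H #> y)) \<le> card ?C"
        using finC rcoset_subset_conjugators[OF H g x] rcoset_subset_conjugators[OF H g y(1)]
        by (intro card_mono) auto
      ultimately show False using few by simp
    qed
    have const: "\<mu> (y \<otimes> g \<otimes> inv y) = \<mu> (x \<otimes> g \<otimes> inv x)" if y_in: "y \<in> ?C" for y
    proof -
      obtain h where h: "h \<in> H" and y: "y = h \<otimes> x" using y_in unfolding C by (auto simp: r_coset_def)
      have "inv\<^bsub>?K\<^esub> h = inv h" using m_inv_consistent[OF H h] by simp
      thus ?thesis
        using linear_character_conjugate[OF K \<mu>, of h "x \<otimes> g \<otimes> inv x"] h c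
          conj_mult[of h x g] HG x' g y by auto
    qed
    have "(\<Sum>y\<in>?C. \<mu> (y \<otimes> g \<otimes> inv y)) = of_nat (card H) * \<mu> (x \<otimes> g \<otimes> inv x)"
      using const C card_coset[OF x'] by simp
    hence "induced G H \<mu> g = \<mu> (x \<otimes> g \<otimes> inv x)" using cardH by (simp add: ind)
    thus ?thesis using linear_character_root_of_unity[OF K _ \<mu>] finH c by simp
  qed
qed

end

theorem theorem2p2:
  fixes G :: "('a, 'b) monoid_scheme"
    and \<chi> :: "'a \<Rightarrow> complex"
  assumes "group G"
    and "finite (carrier G)"
    and "\<chi> \<in> Irr G"
    and "monomial G \<chi>"
  shows "lambda_ratio G \<chi> \<ge> 1 / 2"
proof -
  interpret group G by fact
  note fin = assms(2)
  obtain H \<mu> where H: "subgroup H G" and \<mu>: "\<mu> \<in> linear_characters (G\<lparr>carrier := H\<rparr>)"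
    and \<chi>: "\<chi> = induced G H \<mu>"
    using assms(4) by (auto simp: monomial_def)
  define A where "A = {g \<in> carrier G. \<chi> g = 0 \<or> root_of_unity (\<chi> g)}"
  define B where "B = {g \<in> carrier G. 2 * card H \<le> card (conjugators G H g)}"
  have cardH: "card H > 0"
    using finite_subset[OF subgroup.subset[OF H] fin] subgroup.one_closed[OF H] card_gt_0_iff
    by blast
  have finB: "finite B" and finA: "finite A" using fin by (auto simp: A_def B_def)
  \<comment> \<open>Markov's inequality for the number of fixed cosets, whose average is 1.\<close>
  have "card B * (2 * card H) = (\<Sum>g\<in>B. 2 * card H)" by simp
  also have "\<dots> \<le> (\<Sum>g\<in>B. card (conjugators G H g))" by (rule sum_mono) (simp add: B_def)
  also have "\<dots> \<le> (\<Sum>g\<in>carrier G. card (conjugators G H g))"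
    by (rule sum_mono2) (use fin in \<open>auto simp: B_def\<close>)
  also have "\<dots> = card (carrier G) * card H" by (rule sum_card_conjugators[OF fin H])
  finally have B: "2 * card B \<le> card (carrier G)" using cardH by simp
  have "g \<in> A \<union> B" if "g \<in> carrier G" for g
    using induced_zero_or_root_of_unity[OF fin H \<mu> that] that
    by (simp add: A_def B_def \<chi>) linarith
  hence "carrier G \<subseteq> A \<union> B" by blast
  hence "card (carrier G) \<le> card A + card B"
    using card_mono[of "A \<union> B" "carrier G"] card_Un_le[of A B] finA finB by simp
  hence "card (carrier G) \<le> 2 * card A" using B by simp
  moreover have "card (carrier G) > 0" using fin order_gt_0_iff_finite by (simp add: Coset.order_def)
  ultimately show ?thesis
    by (simp add: lambda_ratio_def A_def[symmetric] Coset.order_def field_simps)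
qed

end
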